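(* Let $\alpha>0$, $\gamma\ge 0$, let $\kappa$ be a fragmentation kernel (with total mass $N$) and let $\mu_0$ be an admissible initial datum with $\operatorname{supp}(\mu_0)\subset[0,L]$. Suppose that $(\mu_t)_{t\ge0}\in \mathcal C(\mathbb R^+,\mathcal M(\mathbb R^+))$ is a non-negative measure-valued solution of the fragmentation equation with initial datum $\mu_0$. Then, for all $t>0$, $$\operatorname{supp}(\mu_t)\subset[0,L],$$ $$\|\mu_t\|_{TV}\le \|\mu_0\|_{TV}\,e^{\alpha(2L)^\gamma(1+N)t},$$ $$\int_{\mathbb R^+}x\,d\mu_t(x)=\int_{\mathbb R^+}x\,d\mu_0(x).$$ In particular, such a solution is unique.
   Context: $\mathbb R^+=[0,\infty)$. $\mathcal M(\mathbb R^+)$ is the space of signed Radon measures supported in $\mathbb R^+$, endowed with the total variation norm $\|\mu\|_{TV}=\sup\{\int\varphi\,d\mu:\ \varphi\in\mathcal C(\mathbb R^+)\cap L^1(d|\mu|),\ \|\varphi\|_\infty\le1\}$, for which it is a Banach space (so its elements are finite measures); $\mathcal M^+(\mathbb R^+)$ is the subset of non-negative measures. $\mathcal C(\mathbb R^+,\mathcal M(\mathbb R^+))$ denotes continuous maps $t\mapsto\mu_t$ for the TV norm. Fragmentation kernel: $\kappa\in\mathcal M^+(\mathbb R^+)$ with no atom at $0$ nor at $1$, $\operatorname{supp}(\kappa)\subset[0,1]$, $\int_0^1 d\kappa(z)=N<+\infty$, $\int_0^1 z\,d\kappa(z)=1$. Admissible initial datum: $\mu_0\in\mathcal M^+(\mathbb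 R^+)$ compactly supported, $\operatorname{supp}(\mu_0)\subset[0,L]$. Fragmentation equation (formally): $\partial_t\mu_t(x)=-\alpha x^\gamma\mu_t(x)+\alpha\int_x^\infty\kappa(x/y)\,y^{\gamma-1}d\mu_t(y)$, $\mu_{t=0}=\mu_0$. A measure-valued solution is a family $(\mu_t)_{t\ge0}\subset\mathcal M(\mathbb R^+)$ such that $t\mapsto\mu_t$ is narrowly continuous (i.e. tested against bounded continuous functions) and, for all $\varphi\in\mathcal C(\mathbb R^+)$ such that $x\mapsto\varphi(x)/(1+x)$ is bounded on $[0,\infty)$ and all $t\ge0$, $$\int_{\mathbb R^+}\varphi\,d\mu_t=\int_{\mathbb R^+}\varphi\,d\mu_0+\int_0^t ds\int_{\mathbb R^+}d\mu_s(x)\,\alpha x^\gamma\Big(-\varphi(x)+\int_0^1 d\kappa(z)\varphi(xz)\Big).$$ *)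

theory Defs
  imports "HOL-Analysis.Analysis"
begin

text \<open>
  A finite non-negative measure on \<open>[0,\<infinity>)\<close> is a finite measure on the Borel sets of the
  subspace \<open>{0..}\<close>, so that functions continuous on \<open>{0..}\<close> are measurable for it whatever
  their values at negative arguments.  Finite Borel measures on this space are Radon.
\<close>

definition nonneg_measures :: "real measure set" where
  "nonneg_measures = {\<mu>. sets \<mu> = sets (restrict_space borel {0..}) \<and> finite_measure \<mu>}"

definition msupp :: "'a::topological_space measure \<Rightarrow> 'a set" where
  "msupp \<mu> = {x \<in> space \<mu>. \<forall>U. open U \<longrightarrow> x \<in> U \<longrightarrow> emeasure \<mu> (U \<inter> space \<mu>) > 0}"

text \<open>
  The total variation norm of a finite signed measure on \<open>[0,\<infinity>)\<close>, given through its integration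
  functional \<open>\<Lambda>\<close>: \<open>\<Lambda> \<phi> = \<integral>\<phi> d\<mu>\<close> for a non-negative measure, and \<open>\<Lambda> \<phi> = \<integral>\<phi> d\<mu> - \<integral>\<phi> d\<nu>\<close> for
  the difference of two of them.  Bounded continuous functions are integrable for finite measures,
  so no integrability condition on \<open>\<phi>\<close> is needed, and the supremum is over a bounded set.
\<close>

definition functional_tv_norm :: "((real \<Rightarrow> real) \<Rightarrow> real) \<Rightarrow> real" where
  "functional_tv_norm \<Lambda> =
     (SUP \<phi>\<in>{\<phi>. continuous_on {0..} \<phi> \<and> (\<forall>x\<ge>0. \<bar>\<phi> x\<bar> \<le> 1)}. \<Lambda> \<phi>)"

definition tv_norm :: "real measure \<Rightarrow> real" where
  "tv_norm \<mu> = functional_tv_norm (\<lambda>\<phi>. LINT x|\<mu>. \<phi> x)"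

definition tv_dist :: "real measure \<Rightarrow> real measure \<Rightarrow> real" where
  "tv_dist \<mu> \<nu> = functional_tv_norm (\<lambda>\<phi>. (LINT x|\<mu>. \<phi> x) - (LINT x|\<nu>. \<phi> x))"

definition tv_continuous :: "(real \<Rightarrow> real measure) \<Rightarrow> bool" where
  "tv_continuous \<mu> \<longleftrightarrow>
     (\<forall>t\<ge>0. ((\<lambda>s. tv_dist (\<mu> s) (\<mu> t)) \<longlongrightarrow> 0) (at t within {0..}))"

definition narrowly_continuous :: "(real \<Rightarrow> real measure) \<Rightarrow> bool" where
  "narrowly_continuous \<mu> \<longleftrightarrow>
     (\<forall>\<phi> :: real \<Rightarrow> real. continuous_on {0..} \<phi> \<longrightarrow> bounded (\<phi> ` {0..}) \<longrightarrow>
        continuous_on {0..} (\<lambda>t. LINT x|\<mu> t. \<phi> x))"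

definition fragmentation_kernel :: "real measure \<Rightarrow> real \<Rightarrow> bool" where
  "fragmentation_kernel \<kappa> N \<longleftrightarrow>
     \<kappa> \<in> nonneg_measures \<and> measure \<kappa> {0} = 0 \<and> measure \<kappa> {1} = 0 \<and>
     msupp \<kappa> \<subseteq> {0..1} \<and>
     (LINT z:{0..1}|\<kappa>. 1) = N \<and> (LINT z:{0..1}|\<kappa>. z) = 1"

text \<open>A support is closed, so the inclusion below entails that it is compact.\<close>

definition admissible_datum :: "real \<Rightarrow> real measure \<Rightarrow> bool" where
  "admissible_datum L \<mu>0 \<longleftrightarrow> \<mu>0 \<in> nonneg_measures \<and> msupp \<mu>0 \<subseteq> {0..L}"

text \<open>
  The power \<open>x\<^sup>\<gamma>\<close> for \<open>x \<ge> 0\<close> and \<open>\<gamma> \<ge> 0\<close>, with \<open>0\<^sup>0 = 1\<close>; the library has \<open>0 powr 0 = 0\<close>,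
  which would be wrong for \<open>\<gamma> = 0\<close> and measures with an atom at \<open>0\<close>.
\<close>

definition rpow :: "real \<Rightarrow> real \<Rightarrow> real" where
  "rpow x \<gamma> = (if \<gamma> = 0 then 1 else x powr \<gamma>)"

definition test_function :: "(real \<Rightarrow> real) \<Rightarrow> bool" where
  "test_function \<phi> \<longleftrightarrow> continuous_on {0..} \<phi> \<and> bounded ((\<lambda>x. \<phi> x / (1 + x)) ` {0..})"

definition frag_op :: "real \<Rightarrow> real \<Rightarrow> real measure \<Rightarrow> (real \<Rightarrow> real) \<Rightarrow> real \<Rightarrow> real" where
  "frag_op \<alpha> \<gamma> \<kappa> \<phi> x = \<alpha> * rpow x \<gamma> * (- \<phi> x + (LINT z:{0..1}|\<kappa>. \<phi> (x * z)))"

text \<open>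
  Non-negative measure-valued solutions.  The integrability clauses say that the integrals in the
  weak formulation make sense; without them a non-integrable integrand would silently count as
  having integral \<open>0\<close>.  Only the values \<open>\<mu> t\<close> for \<open>t \<ge> 0\<close> matter.
\<close>

definition nonneg_solution ::
  "real \<Rightarrow> real \<Rightarrow> real measure \<Rightarrow> real measure \<Rightarrow> (real \<Rightarrow> real measure) \<Rightarrow> bool" where
  "nonneg_solution \<alpha> \<gamma> \<kappa> \<mu>0 \<mu> \<longleftrightarrow>
     (\<forall>t\<ge>0. \<mu> t \<in> nonneg_measures) \<and>
     narrowly_continuous \<mu> \<and>
     (\<forall>\<phi> t. test_function \<phi> \<longrightarrow> t \<ge> 0 \<longrightarrow>
        integrable (\<mu> t) \<phi> \<and>
        (AE s in lborel. s \<in> {0..t} \<longrightarrow> integrable (\<mu> s) (frag_op \<alpha> \<gamma> \<kappa> \<phi>)) \<and>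
        set_integrable lborel {0..t} (\<lambda>s. LINT x|\<mu> s. frag_op \<alpha> \<gamma> \<kappa> \<phi> x) \<and>
        (LINT x|\<mu> t. \<phi> x) =
          (LINT x|\<mu>0. \<phi> x) + (LINT s:{0..t}|lborel. LINT x|\<mu> s. frag_op \<alpha> \<gamma> \<kappa> \<phi> x))"

end

theory Submission
  imports Defs
begin

text \<open>
  Everything follows from three choices of test function in the weak formulation.

  The function \<open>\<phi>(x) = x\<close> is annihilated by the fragmentation operator, because \<open>\<integral> z d\<kappa>(z) = 1\<close>:
  the first moment is conserved.

  The function \<open>\<phi>(x) = max 0 (x - L)\<close> is convex and vanishes at \<open>0\<close>, so \<open>\<phi>(x z) \<le> z \<phi>(x)\<close> for
  \<open>0 \<le> z \<le> 1\<close>, and the operator sends it to a non-positive function: fragmentation does not create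
  mass beyond \<open>L\<close>.  Hence \<open>\<integral> \<phi> d\<mu>\<^sub>t \<le> \<integral> \<phi> d\<mu>\<^sub>0 = 0\<close>, and \<open>\<mu>\<^sub>t\<close> is carried by \<open>[0,L]\<close>.

  Once this is known, only the values of the operator on \<open>[0,L]\<close> matter.  There it maps the unit
  ball of bounded continuous functions into \<open>C\<close> times itself, with \<open>C = \<alpha> L\<^sup>\<gamma> (1 + N)\<close> or anything
  larger.  So for each \<open>\<phi>\<close> in the unit ball there is a \<open>\<psi>\<close> in the unit ball, the same for all
  solutions and all times, with
  \<open>\<integral> \<phi> d\<mu>\<^sub>t = \<integral> \<phi> d\<mu>\<^sub>0 + C \<integral>\<^sub>0\<^sup>t \<integral> \<psi> d\<mu>\<^sub>s ds\<close> (lemma \<open>solution_duhamel\<close>).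
  A Gronwall inequality for families closed under \<open>\<phi> \<mapsto> \<psi>\<close> (lemma \<open>gronwall_family\<close>) then gives
  both remaining claims: applied to \<open>\<integral> \<phi> d\<mu>\<^sub>t\<close> it bounds the total variation by
  \<open>\<parallel>\<mu>\<^sub>0\<parallel> e\<^sup>C\<^sup>t\<close>, and applied to \<open>\<integral> \<phi> d\<mu>\<^sub>t - \<integral> \<phi> d\<nu>\<^sub>t\<close>, where the initial terms cancel, it shows
  that two solutions have the same integrals, hence are equal.
\<close>

section \<open>A Gronwall inequality for families of functions\<close>

text \<open>
  Working with the whole family instead of with \<open>t \<mapsto> sup\<^sub>i f i t\<close> avoids having to know that this
  supremum is measurable.  The proof is the Picard iteration: inserting the a priori bound \<open>M\<close>
  into the hypothesis \<open>n\<close> times leaves the remainder \<open>M (C t)\<^sup>n / n!\<close>, which tends to \<open>0\<close>.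
\<close>

lemma gronwall_family:
  fixes f :: "'i \<Rightarrow> real \<Rightarrow> real"
  assumes "C \<ge> 0" "a \<ge> 0"
    and bound: "\<And>i t. i \<in> I \<Longrightarrow> t \<in> {0..T} \<Longrightarrow> f i t \<le> M"
    and integrable: "\<And>i t. i \<in> I \<Longrightarrow> t \<in> {0..T} \<Longrightarrow> set_integrable lborel {0..t} (f i)"
    and step: "\<And>i t. i \<in> I \<Longrightarrow> t \<in> {0..T} \<Longrightarrow>
                 \<exists>j\<in>I. f i t \<le> a + C * (LINT s:{0..t}|lborel. f j s)"
    and "i \<in> I" "t \<in> {0..T}"
  shows "f i t \<le> a * exp (C * t)"
proof -
  have iterate: "f i t \<le> a * exp (C * t) + M * ((C * t) ^ n / fact n)"
    if "i \<in> I" "t \<in> {0..T}" for i t n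
    using that
  proof (induction n arbitrary: i t)
    case 0
    have "0 \<le> a * exp (C * t)"
      using \<open>a \<ge> 0\<close> by simp
    with bound[OF 0] show ?case by simp
  next
    case (Suc n)
    \<comment> \<open>\<open>F'\<close> is the bound from the induction hypothesis and \<open>F\<close> the new one; \<open>F\<close> is the primitive of \<open>C F'\<close> with \<open>F 0 = a\<close>.\<close>
    define F where "F s = a * exp (C * s) + M * ((C * s) ^ Suc n / fact (Suc n))" for s
    define F' where "F' s = a * exp (C * s) + M * ((C * s) ^ n / fact n)" for s
    obtain j where j: "j \<in> I" "f i t \<le> a + C * (LINT s:{0..t}|lborel. f j s)"
      using step[OF Suc.prems] by blast
    have F'_cont: "continuous_on {0..t} F'"
      unfolding F'_def by (intro continuous_intros) auto
    have "(LINT s:{0..t}|lborel. f j s) \<le> (LINT s:{0..t}|lborel. F' s)"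
    proof (rule set_integral_mono)
      show "set_integrable lborel {0..t} (f j)"
        by (rule integrable[OF j(1) Suc.prems(2)])
      show "set_integrable lborel {0..t} F'"
        by (rule borel_integrable_atLeastAtMost'[OF F'_cont])
      show "f j s \<le> F' s" if "s \<in> {0..t}" for s
        using Suc.IH[OF j(1), of s] that Suc.prems(2) by (simp add: F'_def)
    qed
    then have "f i t \<le> a + C * (LINT s:{0..t}|lborel. F' s)"
      using j(2) mult_left_mono[OF _ \<open>C \<ge> 0\<close>] by fastforce
    also have "C * (LINT s:{0..t}|lborel. F' s) = (LINT s:{0..t}|lborel. C * F' s)"
      by simp
    also have "\<dots> = F t - F 0"
      unfolding set_lebesgue_integral_def
    proof (rule integral_FTC_atLeastAtMost)
      show "0 \<le> t"
        using Suc.prems by simp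
      show "continuous_on {0..t} (\<lambda>s. C * F' s)"
        by (intro continuous_intros F'_cont)
      have cancel: "real (Suc n) * x / fact (Suc n) = x / fact n" for x
        by (simp add: divide_simps)
      have "(F has_real_derivative C * F' s) (at s within {0..t})" for s
        unfolding F_def F'_def
        by (auto intro!: derivative_eq_intros simp del: of_nat_Suc power_Suc fact_Suc
              simp: cancel algebra_simps) (simp add: cancel[symmetric] algebra_simps)
      then show "(F has_vector_derivative C * F' s) (at s within {0..t})" for s
        by (simp add: has_real_derivative_iff_has_vector_derivative)
    qed
    also have "a + (F t - F 0) = F t"
      by (simp add: F_def)
    finally show ?case
      by (simp add: F_def)
  qed
  have "(\<lambda>n. (C * t) ^ n / fact n) \<longlonglongrightarrow> 0"
    using summable_LIMSEQ_zero[OF summable_exp[of "C * t"]] by (simp add: field_simps)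
  then have "(\<lambda>n. a * exp (C * t) + M * ((C * t) ^ n / fact n)) \<longlonglongrightarrow> a * exp (C * t) + M * 0"
    by (intro tendsto_intros)
  then show ?thesis
    using iterate[OF \<open>i \<in> I\<close> \<open>t \<in> {0..T}\<close>]
    by (intro LIMSEQ_le_const[of _ "a * exp (C * t)"]) auto
qed

section \<open>Finite measures on the half-line\<close>

lemma space_nonneg_measures: "\<mu> \<in> nonneg_measures \<Longrightarrow> space \<mu> = {0..}"
  using sets_eq_imp_space_eq[of \<mu> "restrict_space borel {0..}"]
  by (simp add: nonneg_measures_def space_restrict_space)

lemma finite_measure_nonneg_measures: "\<mu> \<in> nonneg_measures \<Longrightarrow> finite_measure \<mu>"
  by (simp add: nonneg_measures_def)

lemma sets_nonneg_measures:
  assumes "\<mu> \<in> nonneg_measures" "A \<in> sets borel"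
  shows "A \<inter> {0..} \<in> sets \<mu>"
  using assms by (auto simp: nonneg_measures_def sets_restrict_space)

lemma borel_measurable_nonneg_measures:
  fixes \<phi> :: "real \<Rightarrow> real"
  assumes "\<mu> \<in> nonneg_measures" "continuous_on {0..} \<phi>"
  shows "\<phi> \<in> borel_measurable \<mu>"
proof -
  have "sets \<mu> = sets (restrict_space borel {0..})"
    using assms(1) by (simp add: nonneg_measures_def)
  from measurable_cong_sets[OF this refl] show ?thesis
    using borel_measurable_continuous_on_restrict[OF assms(2)] by blast
qed

text \<open>
  Points outside the support have null neighbourhoods; second countability reduces the union of
  all these neighbourhoods to a countable union of null basic open sets.
\<close>

lemma AE_in_msupp:
  fixes M :: "'a::second_countable_topology measure"
  assumes sets: "\<And>U. open U \<Longrightarrow> U \<inter> space M \<in> sets M"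
  shows "AE x in M. x \<in> msupp M"
proof -
  obtain B :: "'a set set" where B: "countable B" "topological_basis B"
    using ex_countable_basis by blast
  define N where "N = {U \<in> B. emeasure M (U \<inter> space M) = 0}"
  have "countable N"
    using B(1) by (simp add: N_def)
  moreover have "AE x in M. x \<notin> U" if "U \<in> N" for U
  proof (rule AE_I)
    show "{x \<in> space M. \<not> x \<notin> U} \<subseteq> U \<inter> space M" by auto
    show "U \<inter> space M \<in> sets M"
      using that B(2) topological_basis_open by (auto simp: N_def intro!: sets)
  qed (use that in \<open>simp add: N_def\<close>)
  ultimately have "AE x in M. \<forall>U\<in>N. x \<notin> U"
    by (simp add: AE_ball_countable)
  then show ?thesis
  proof (rule AE_mp, intro AE_I2 impI)
    fix x assume x: "x \<in> space M" "\<forall>U\<in>N. x \<notin> U"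
    have "emeasure M (U \<inter> space M) > 0" if U: "open U" "x \<in> U" for U
    proof -
      obtain V where V: "V \<in> B" "x \<in> V" "V \<subseteq> U"
        using topological_basisE[OF B(2) U] by blast
      then have "0 < emeasure M (V \<inter> space M)"
        using x(2) by (auto simp: N_def zero_less_iff_neq_zero)
      also have "\<dots> \<le> emeasure M (U \<inter> space M)"
        using V(3) sets[OF U(1)] by (intro emeasure_mono) auto
      finally show ?thesis .
    qed
    with x(1) show "x \<in> msupp M"
      by (simp add: msupp_def)
  qed
qed

lemma AE_le_of_msupp:
  assumes "\<mu> \<in> nonneg_measures" "msupp \<mu> \<subseteq> {0..L}"
  shows "AE x in \<mu>. x \<le> L"
proof -
  have "AE x in \<mu>. x \<in> msupp \<mu>"
    using sets_nonneg_measures[OF assms(1)] space_nonneg_measures[OF assms(1)]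
    by (intro AE_in_msupp) auto
  then show ?thesis
    by eventually_elim (use assms(2) in auto)
qed

lemma msupp_of_AE_le:
  assumes "\<mu> \<in> nonneg_measures" "AE x in \<mu>. x \<le> L"
  shows "msupp \<mu> \<subseteq> {0..L}"
proof
  fix x assume x: "x \<in> msupp \<mu>"
  have "emeasure \<mu> ({L<..} \<inter> {0..}) = 0"
    using assms(2) sets_nonneg_measures[OF assms(1), of "{L<..}"] space_nonneg_measures[OF assms(1)]
    by (subst (asm) AE_iff_measurable[of "{L<..} \<inter> {0..}"]) auto
  moreover have "x \<ge> 0"
    using x by (simp add: msupp_def space_nonneg_measures[OF assms(1)])
  moreover have "emeasure \<mu> ({L<..} \<inter> {0..}) > 0" if "L < x"
  proof -
    have "\<forall>U. open U \<longrightarrow> x \<in> U \<longrightarrow> emeasure \<mu> (U \<inter> {0..}) > 0"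
      using x by (simp add: msupp_def space_nonneg_measures[OF assms(1)])
    with that show ?thesis by force
  qed
  ultimately show "x \<in> {0..L}"
    by force
qed

section \<open>The unit ball of bounded continuous functions\<close>

definition test_ball :: "(real \<Rightarrow> real) set" where
  "test_ball = {\<phi>. continuous_on {0..} \<phi> \<and> (\<forall>x\<ge>0. \<bar>\<phi> x\<bar> \<le> 1)}"

lemma test_ballD:
  assumes "\<phi> \<in> test_ball"
  shows "continuous_on {0..} \<phi>" "\<And>x. x \<ge> 0 \<Longrightarrow> \<bar>\<phi> x\<bar> \<le> 1"
  using assms by (auto simp: test_ball_def)

lemma one_in_test_ball: "(\<lambda>x. 1) \<in> test_ball"
  by (simp add: test_ball_def)

lemma test_function_test_ball:
  assumes "\<phi> \<in> test_ball"
  shows "test_function \<phi>"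
  unfolding test_function_def
proof
  show "bounded ((\<lambda>x. \<phi> x / (1 + x)) ` {0..})"
    using test_ballD(2)[OF assms] by (intro boundedI[of _ 1]) (force simp: divide_simps)
qed (rule test_ballD(1)[OF assms])

lemma integrable_test_ball:
  assumes "\<mu> \<in> nonneg_measures" "\<phi> \<in> test_ball"
  shows "integrable \<mu> \<phi>"
proof -
  interpret finite_measure \<mu>
    by (rule finite_measure_nonneg_measures[OF assms(1)])
  show ?thesis
    using test_ballD[OF assms(2)] borel_measurable_nonneg_measures[OF assms(1)]
    by (intro integrable_const_bound[where B = 1])
       (auto simp: space_nonneg_measures[OF assms(1)])
qed

lemma abs_integral_test_ball_le:
  assumes "\<mu> \<in> nonneg_measures" "\<phi> \<in> test_ball"
  shows "\<bar>LINT x|\<mu>. \<phi> x\<bar> \<le> (LINT x|\<mu>. 1)"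
proof -
  have "\<bar>LINT x|\<mu>. \<phi> x\<bar> \<le> (LINT x|\<mu>. \<bar>\<phi> x\<bar>)"
    by (rule integral_abs_bound)
  also have "\<dots> \<le> (LINT x|\<mu>. 1)"
    using test_ballD[OF assms(2)] integrable_test_ball[OF assms] space_nonneg_measures[OF assms(1)]
      integrable_test_ball[OF assms(1) one_in_test_ball]
    by (intro integral_mono) auto
  finally show ?thesis .
qed

text \<open>For a non-negative measure the supremum in the norm is attained at \<open>\<phi> = 1\<close>.\<close>

lemma tv_norm_nonneg_measure:
  assumes "\<mu> \<in> nonneg_measures"
  shows "tv_norm \<mu> = (LINT x|\<mu>. 1)"
  unfolding tv_norm_def functional_tv_norm_def test_ball_def[symmetric]
proof (rule cSup_eq_maximum)
  show "(LINT x|\<mu>. 1) \<in> (\<lambda>\<phi>. LINT x|\<mu>. \<phi> x) ` test_ball"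
    using one_in_test_ball by (rule rev_image_eqI) simp
  show "r \<le> (LINT x|\<mu>. 1)" if "r \<in> (\<lambda>\<phi>. LINT x|\<mu>. \<phi> x) ` test_ball" for r
    using that abs_integral_test_ball_le[OF assms] by (force simp: abs_le_iff)
qed

text \<open>
  Open half-lines generate the Borel sets, and their indicators are pointwise limits of continuous
  ramps in the unit ball, so dominated convergence transfers the equality of integrals to them.
\<close>

lemma nonneg_measures_eqI:
  assumes \<mu>: "\<mu> \<in> nonneg_measures" and \<nu>: "\<nu> \<in> nonneg_measures"
    and eq: "\<And>\<phi>. \<phi> \<in> test_ball \<Longrightarrow> (LINT x|\<mu>. \<phi> x) = (LINT x|\<nu>. \<phi> x)"
  shows "\<mu> = \<nu>"
proof -
  define g :: "real \<Rightarrow> nat \<Rightarrow> real \<Rightarrow> real" where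
    "g a n x = max 0 (min 1 (real n * (x - a)))" for a n x
  have g_ball: "g a n \<in> test_ball" for a n
    unfolding test_ball_def g_def by (auto intro!: continuous_intros)
  have g_lim: "(\<lambda>n. g a n x) \<longlonglongrightarrow> indicator {a<..} x" for a x
  proof (cases "a < x")
    case True
    have "\<forall>\<^sub>F n in sequentially. g a n x = 1"
    proof -
      have "\<forall>\<^sub>F n in sequentially. 1 / (x - a) \<le> real n"
        using filterlim_real_sequentially unfolding filterlim_at_top by blast
      then show ?thesis
        by eventually_elim (use True in \<open>auto simp: g_def field_simps\<close>)
    qed
    with True show ?thesis
      by (simp add: tendsto_eventually)
  next
    case False
    then have "real n * (x - a) \<le> 0" for n
      by (intro mult_nonneg_nonpos) auto
    then have "g a n x = 0" for n
      by (metis g_def max_absorb1 min.coboundedI2)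
    with False show ?thesis
      by simp
  qed
  have lim: "(\<lambda>n. LINT x|\<rho>. g a n x) \<longlonglongrightarrow> measure \<rho> ({a<..} \<inter> {0..})"
    if \<rho>: "\<rho> \<in> nonneg_measures" for \<rho> a
  proof -
    have meas: "{a<..} \<inter> {0..} \<in> sets \<rho>"
      by (rule sets_nonneg_measures[OF \<rho>]) simp
    have "(\<lambda>n. LINT x|\<rho>. g a n x) \<longlonglongrightarrow> (LINT x|\<rho>. indicator ({a<..} \<inter> {0..}) x)"
    proof (rule integral_dominated_convergence[where w = "\<lambda>x. 1"])
      show "indicat_real ({a<..} \<inter> {0..}) \<in> borel_measurable \<rho>"
        using meas by simp
      show "g a n \<in> borel_measurable \<rho>" for n
        using integrable_test_ball[OF \<rho> g_ball] by auto
      show "AE x in \<rho>. (\<lambda>n. g a n x) \<longlonglongrightarrow> indicator ({a<..} \<inter> {0..}) x"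
        using g_lim by (intro AE_I2) (auto simp: space_nonneg_measures[OF \<rho>] indicator_inter_arith)
      show "AE x in \<rho>. norm (g a n x) \<le> 1" for n
        by (auto simp: g_def)
    qed (rule integrable_test_ball[OF \<rho> one_in_test_ball])
    then show ?thesis
      using meas space_nonneg_measures[OF \<rho>] by (simp add: Int_absorb2)
  qed
  have half_lines: "emeasure \<mu> ({a<..} \<inter> {0..}) = emeasure \<nu> ({a<..} \<inter> {0..})" for a
  proof -
    have "measure \<mu> ({a<..} \<inter> {0..}) = measure \<nu> ({a<..} \<inter> {0..})"
      using lim[OF \<mu>, of a] lim[OF \<nu>, of a] eq[OF g_ball] by (simp add: LIMSEQ_unique)
    then show ?thesis
      using finite_measure.emeasure_eq_measure[OF finite_measure_nonneg_measures[OF \<mu>]]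
        finite_measure.emeasure_eq_measure[OF finite_measure_nonneg_measures[OF \<nu>]] by simp
  qed
  \<comment> \<open>Pushing forward to the whole line makes the uniqueness theorem for Borel measures on the reals applicable.\<close>
  have id: "(\<lambda>x. x) \<in> measurable \<rho> borel" if "\<rho> \<in> nonneg_measures" for \<rho>
    using borel_measurable_nonneg_measures[OF that, of "\<lambda>x. x"] by simp
  have push: "emeasure (distr \<rho> borel (\<lambda>x. x)) A = emeasure \<rho> (A \<inter> {0..})"
    if "\<rho> \<in> nonneg_measures" "A \<in> sets borel" for \<rho> A
    using that by (simp add: emeasure_distr id space_nonneg_measures vimage_def Int_def)
  have distr_eq: "distr \<mu> borel (\<lambda>x. x) = distr \<nu> borel (\<lambda>x. x)"
  proof (rule measure_eqI_lessThan)
    show "emeasure (distr \<mu> borel (\<lambda>x. x)) {a<..} < \<infinity>" for a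
      using finite_measure.emeasure_finite[OF finite_measure_nonneg_measures[OF \<mu>]]
      by (simp add: push \<mu> less_top)
    show "emeasure (distr \<mu> borel (\<lambda>x. x)) {a<..} = emeasure (distr \<nu> borel (\<lambda>x. x)) {a<..}" for a
      using half_lines by (simp add: push \<mu> \<nu>)
  qed simp_all
  show ?thesis
  proof (rule measure_eqI)
    show "sets \<mu> = sets \<nu>"
      using \<mu> \<nu> by (simp add: nonneg_measures_def)
    fix A assume "A \<in> sets \<mu>"
    then obtain B where "B \<in> sets borel" "A = B \<inter> {0..}"
      using \<mu> by (auto simp: nonneg_measures_def sets_restrict_space)
    with push[OF \<mu>, of B] push[OF \<nu>, of B] distr_eq show "emeasure \<mu> A = emeasure \<nu> A"
      by simp
  qed
qed

section \<open>The fragmentation operator\<close>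

lemma rpow_nonneg: "rpow x \<gamma> \<ge> 0"
  by (simp add: rpow_def)

lemma rpow_mono: "0 \<le> \<gamma> \<Longrightarrow> 0 \<le> x \<Longrightarrow> x \<le> y \<Longrightarrow> rpow x \<gamma> \<le> rpow y \<gamma>"
  by (simp add: rpow_def powr_mono2)

lemma continuous_on_rpow:
  assumes "0 \<le> \<gamma>"
  shows "continuous_on {0..} (\<lambda>x. rpow x \<gamma>)"
proof (cases "\<gamma> = 0")
  case False
  then show ?thesis
    using assms by (auto simp: rpow_def intro!: continuous_on_powr')
qed (simp add: rpow_def)

text \<open>
  As \<open>z\<close> runs through \<open>[0,1]\<close>, \<open>x z\<close> stays in the compact interval \<open>[0,x]\<close>, where \<open>\<phi>\<close> is bounded.
\<close>

lemma set_integrable_kernel: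
  assumes \<kappa>: "\<kappa> \<in> nonneg_measures" and \<phi>: "continuous_on {0..} \<phi>" and "x \<ge> 0"
  shows "set_integrable \<kappa> {0..1} (\<lambda>z. \<phi> (x * z) :: real)"
proof -
  interpret finite_measure \<kappa>
    by (rule finite_measure_nonneg_measures[OF \<kappa>])
  have cont: "continuous_on {0..} (\<lambda>z. \<phi> (x * z))"
    using \<open>x \<ge> 0\<close> by (intro continuous_on_compose2[OF \<phi>] continuous_intros) auto
  have "compact ((\<lambda>z. \<phi> (x * z)) ` {0..1})"
    by (intro compact_continuous_image continuous_on_subset[OF cont]) auto
  then obtain B where B: "\<And>z. z \<in> {0..1} \<Longrightarrow> norm (\<phi> (x * z)) \<le> B"
    using compact_imp_bounded[THEN bounded_iff[THEN iffD1]] by (metis imageI)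
  have "{0..1} \<in> sets \<kappa>"
    using sets_nonneg_measures[OF \<kappa>, of "{0..1}"] by (simp add: Int_absorb2)
  then show ?thesis
    unfolding set_integrable_def
    using B borel_measurable_nonneg_measures[OF \<kappa> cont]
    by (intro integrable_const_bound[where B = "max 0 B"])
       (auto intro!: AE_I2 simp: le_max_iff_disj split: split_indicator)
qed

lemma continuous_on_kernel_average:
  assumes \<kappa>: "\<kappa> \<in> nonneg_measures" and \<phi>: "\<phi> \<in> test_ball"
  shows "continuous_on {0..} (\<lambda>x. LINT z:{0..1}|\<kappa>. \<phi> (x * z))"
  unfolding continuous_on_sequentially
proof (intro allI ballI impI, elim conjE)
  interpret finite_measure \<kappa>
    by (rule finite_measure_nonneg_measures[OF \<kappa>])
  fix u and a :: real
  assume a: "a \<in> {0..}" and u: "\<forall>n. u n \<in> {0..}" and lim: "u \<longlonglongrightarrow> a"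
  have "(\<lambda>n. LINT z:{0..1}|\<kappa>. \<phi> (u n * z)) \<longlonglongrightarrow> (LINT z:{0..1}|\<kappa>. \<phi> (a * z))"
    unfolding set_lebesgue_integral_def
  proof (rule integral_dominated_convergence[where w = "\<lambda>z. 1"])
    show "AE z in \<kappa>. (\<lambda>n. indicat_real {0..1} z *\<^sub>R \<phi> (u n * z))
            \<longlonglongrightarrow> indicat_real {0..1} z *\<^sub>R \<phi> (a * z)"
    proof (intro AE_I2 tendsto_intros)
      fix z assume "z \<in> space \<kappa>"
      then have "z \<ge> 0"
        using space_nonneg_measures[OF \<kappa>] by simp
      then show "(\<lambda>n. \<phi> (u n * z)) \<longlonglongrightarrow> \<phi> (a * z)"
        using a u by (intro continuous_on_tendsto_compose[OF test_ballD(1)[OF \<phi>]] tendsto_intros lim)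
          auto
    qed
    show "AE z in \<kappa>. norm (indicat_real {0..1} z *\<^sub>R \<phi> (u n * z)) \<le> 1" for n
      using u test_ballD(2)[OF \<phi>] by (auto split: split_indicator)
    show "(\<lambda>z. indicat_real {0..1} z *\<^sub>R \<phi> (u n * z)) \<in> borel_measurable \<kappa>" for n
      using set_integrable_kernel[OF \<kappa> test_ballD(1)[OF \<phi>], of "u n"] u
      by (auto simp: set_integrable_def)
    show "(\<lambda>z. indicat_real {0..1} z *\<^sub>R \<phi> (a * z)) \<in> borel_measurable \<kappa>"
      using set_integrable_kernel[OF \<kappa> test_ballD(1)[OF \<phi>], of a] a
      by (auto simp: set_integrable_def)
  qed simp
  then show "((\<lambda>x. LINT z:{0..1}|\<kappa>. \<phi> (x * z)) \<circ> u) \<longlonglongrightarrow> (LINT z:{0..1}|\<kappa>. \<phi> (a * z))"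
    by (simp add: comp_def)
qed

lemma continuous_on_frag_op:
  assumes "0 \<le> \<gamma>" "\<kappa> \<in> nonneg_measures" "\<phi> \<in> test_ball"
  shows "continuous_on {0..} (frag_op \<alpha> \<gamma> \<kappa> \<phi>)"
  unfolding frag_op_def[abs_def]
  by (intro continuous_intros continuous_on_rpow continuous_on_kernel_average
        test_ballD(1) assms)

lemma abs_frag_op_le:
  assumes "0 \<le> \<alpha>" "0 \<le> \<gamma>" and \<kappa>: "\<kappa> \<in> nonneg_measures" and \<phi>: "\<phi> \<in> test_ball" and x: "0 \<le> x"
  shows "\<bar>frag_op \<alpha> \<gamma> \<kappa> \<phi> x\<bar> \<le> \<alpha> * rpow x \<gamma> * (1 + (LINT z:{0..1}|\<kappa>. 1))"
proof -
  have int: "set_integrable \<kappa> {0..1} (\<lambda>z. \<phi> (x * z))"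
    by (rule set_integrable_kernel[OF \<kappa> test_ballD(1)[OF \<phi>] x])
  have "\<bar>LINT z:{0..1}|\<kappa>. \<phi> (x * z)\<bar> \<le> (LINT z:{0..1}|\<kappa>. \<bar>\<phi> (x * z)\<bar>)"
    using set_integral_norm_bound[OF int] by simp
  also have "\<dots> \<le> (LINT z:{0..1}|\<kappa>. 1)"
    using test_ballD(2)[OF \<phi>] x set_integrable_abs[OF int]
      set_integrable_kernel[OF \<kappa> test_ballD(1)[OF one_in_test_ball] x]
    by (intro set_integral_mono) auto
  finally have "\<bar>- \<phi> x + (LINT z:{0..1}|\<kappa>. \<phi> (x * z))\<bar> \<le> 1 + (LINT z:{0..1}|\<kappa>. 1)"
    using test_ballD(2)[OF \<phi> x] by linarith
  then show ?thesis
    unfolding frag_op_def abs_mult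
    using assms(1) rpow_nonneg[of x \<gamma>] by (simp add: mult_left_mono)
qed

text \<open>
  The operator does not preserve boundedness on \<open>[0,\<infinity>)\<close> when \<open>\<gamma> > 0\<close>, because of the factor \<open>x\<^sup>\<gamma>\<close>.  For measures
  carried by \<open>[0,L]\<close> its result may be changed beyond \<open>L\<close>: freezing it at its value at \<open>L\<close> and
  dividing by \<open>C\<close> gives a function \<open>\<psi>\<close> of the unit ball.
\<close>

lemma frag_op_rescaled:
  assumes "0 \<le> \<alpha>" "0 \<le> \<gamma>" "0 \<le> L" and \<kappa>: "\<kappa> \<in> nonneg_measures" and \<phi>: "\<phi> \<in> test_ball"
    and C: "\<alpha> * rpow L \<gamma> * (1 + (LINT z:{0..1}|\<kappa>. 1)) \<le> C"
  obtains \<psi> where "\<psi> \<in> test_ball"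
    and "\<And>\<rho>. \<rho> \<in> nonneg_measures \<Longrightarrow> (AE x in \<rho>. x \<le> L) \<Longrightarrow>
           (LINT x|\<rho>. frag_op \<alpha> \<gamma> \<kappa> \<phi> x) = C * (LINT x|\<rho>. \<psi> x)"
proof
  let ?A = "frag_op \<alpha> \<gamma> \<kappa> \<phi>"
  define \<psi> where "\<psi> x = ?A (min x L) / C" for x
  have "0 \<le> (LINT z:{0..1}|\<kappa>. 1 :: real)"
    unfolding set_lebesgue_integral_def by (intro Bochner_Integration.integral_nonneg) simp
  then have bound: "\<bar>?A x\<bar> \<le> C" if "0 \<le> x" "x \<le> L" for x
    using abs_frag_op_le[OF assms(1,2) \<kappa> \<phi> that(1)] rpow_mono[OF \<open>0 \<le> \<gamma>\<close> that] \<open>0 \<le> \<alpha>\<close>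
    by (intro order_trans[OF _ C])
       (erule order_trans, intro mult_right_mono mult_left_mono, auto)
  have cont: "continuous_on {0..} (\<lambda>x. ?A (min x L))"
    using \<open>0 \<le> L\<close>
    by (intro continuous_on_compose2[OF continuous_on_frag_op[OF \<open>0 \<le> \<gamma>\<close> \<kappa> \<phi>]] continuous_intros) auto
  have "\<bar>\<psi> x\<bar> \<le> 1" if "x \<ge> 0" for x
    using bound[of "min x L"] that \<open>0 \<le> L\<close> by (auto simp: \<psi>_def abs_divide divide_le_eq_1)
  moreover have "continuous_on {0..} \<psi>"
    using continuous_on_mult_right[OF cont, of "inverse C"]
    by (simp add: \<psi>_def[abs_def] divide_inverse)
  ultimately show ball: "\<psi> \<in> test_ball"
    by (simp add: test_ball_def)
  fix \<rho> assume \<rho>: "\<rho> \<in> nonneg_measures" and L: "AE x in \<rho>. x \<le> L"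
  have "(LINT x|\<rho>. ?A x) = (LINT x|\<rho>. C * \<psi> x)"
  proof (rule integral_cong_AE)
    show "?A \<in> borel_measurable \<rho>"
      by (rule borel_measurable_nonneg_measures[OF \<rho> continuous_on_frag_op[OF \<open>0 \<le> \<gamma>\<close> \<kappa> \<phi>]])
    show "(\<lambda>x. C * \<psi> x) \<in> borel_measurable \<rho>"
      using borel_measurable_nonneg_measures[OF \<rho> test_ballD(1)[OF ball]] by simp
    show "AE x in \<rho>. ?A x = C * \<psi> x"
      using L AE_space
    proof eventually_elim
      case (elim x)
      then have "0 \<le> x"
        using space_nonneg_measures[OF \<rho>] by simp
      \<comment> \<open>For \<open>C = 0\<close> the bound forces the operator to vanish on \<open>[0,L]\<close>, in accordance with \<open>y / 0 = 0\<close>.\<close>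
      with bound[of x] elim(1) show ?case
        by (cases "C = 0") (auto simp: \<psi>_def)
    qed
  qed
  then show "(LINT x|\<rho>. ?A x) = C * (LINT x|\<rho>. \<psi> x)"
    by simp
qed

section \<open>Properties of solutions\<close>

lemma nonneg_solutionD:
  assumes "nonneg_solution \<alpha> \<gamma> \<kappa> \<mu>0 \<mu>" "t \<ge> 0"
  shows "\<mu> t \<in> nonneg_measures"
    and "test_function \<phi> \<Longrightarrow> integrable (\<mu> t) \<phi>"
    and "test_function \<phi> \<Longrightarrow> (LINT x|\<mu> t. \<phi> x) =
           (LINT x|\<mu>0. \<phi> x) + (LINT s:{0..t}|lborel. LINT x|\<mu> s. frag_op \<alpha> \<gamma> \<kappa> \<phi> x)"
  using assms unfolding nonneg_solution_def by blast+

lemma continuous_on_integral_test_ball: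
  assumes "nonneg_solution \<alpha> \<gamma> \<kappa> \<mu>0 \<mu>" "\<phi> \<in> test_ball"
  shows "continuous_on {0..} (\<lambda>t. LINT x|\<mu> t. \<phi> x)"
proof -
  have "bounded (\<phi> ` {0..})"
    using test_ballD(2)[OF assms(2)] by (intro boundedI[of _ 1]) auto
  with assms test_ballD(1)[OF assms(2)] show ?thesis
    unfolding nonneg_solution_def narrowly_continuous_def by blast
qed

lemma first_moment_conserved:
  assumes "fragmentation_kernel \<kappa> N" "nonneg_solution \<alpha> \<gamma> \<kappa> \<mu>0 \<mu>" "t \<ge> 0"
  shows "(LINT x|\<mu> t. x) = (LINT x|\<mu>0. x)"
proof -
  have "test_function (\<lambda>x. x)"
    unfolding test_function_def by (auto intro!: boundedI[of _ 1])
  moreover have "frag_op \<alpha> \<gamma> \<kappa> (\<lambda>x. x) x = 0" for x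
    using assms(1) by (simp add: frag_op_def fragmentation_kernel_def)
  ultimately show ?thesis
    using nonneg_solutionD(3)[OF assms(2,3), of "\<lambda>x. x"] by simp
qed

text \<open>
  The test function \<open>\<phi>(x) = max 0 (x - L)\<close> vanishes exactly on \<open>[0,L]\<close> and satisfies
  \<open>\<phi>(x z) \<le> z \<phi>(x)\<close> for \<open>0 \<le> z \<le> 1\<close>; the latter, with \<open>\<integral> z d\<kappa>(z) = 1\<close>, keeps its integral
  below the initial value \<open>0\<close>.
\<close>

lemma solution_concentrated:
  assumes "0 \<le> \<alpha>" "0 \<le> L" and kernel: "fragmentation_kernel \<kappa> N" and "admissible_datum L \<mu>0"
    and sol: "nonneg_solution \<alpha> \<gamma> \<kappa> \<mu>0 \<mu>" and "t \<ge> 0"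
  shows "AE x in \<mu> t. x \<le> L"
proof -
  define \<phi> where "\<phi> x = max 0 (x - L)" for x :: real
  have \<kappa>: "\<kappa> \<in> nonneg_measures" and mean: "(LINT z:{0..1}|\<kappa>. z) = 1"
    using kernel by (auto simp: fragmentation_kernel_def)
  have \<mu>0: "\<mu>0 \<in> nonneg_measures" "msupp \<mu>0 \<subseteq> {0..L}"
    using assms(4) by (auto simp: admissible_datum_def)
  have cont: "continuous_on {0..} \<phi>"
    unfolding \<phi>_def by (intro continuous_intros)
  have test: "test_function \<phi>"
    unfolding test_function_def
  proof
    show "bounded ((\<lambda>x. \<phi> x / (1 + x)) ` {0..})"
      using \<open>0 \<le> L\<close> by (intro boundedI[of _ 1]) (auto simp: \<phi>_def divide_simps)
  qed (rule cont)
  have op_nonpos: "frag_op \<alpha> \<gamma> \<kappa> \<phi> x \<le> 0" if x: "x \<ge> 0" for x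
  proof -
    have "(LINT z:{0..1}|\<kappa>. \<phi> (x * z)) \<le> (LINT z:{0..1}|\<kappa>. \<phi> x * z)"
    proof (rule set_integral_mono)
      show "set_integrable \<kappa> {0..1} (\<lambda>z. \<phi> (x * z))"
        by (rule set_integrable_kernel[OF \<kappa> cont x])
      show "set_integrable \<kappa> {0..1} (\<lambda>z. \<phi> x * z)"
        using set_integrable_kernel[OF \<kappa>, of "\<lambda>z. \<phi> x * z" 1]
        by (simp add: continuous_intros)
      show "\<phi> (x * z) \<le> \<phi> x * z" if z: "z \<in> {0..1}" for z
      proof -
        have "z * L \<le> L"
          using z \<open>0 \<le> L\<close> by (simp add: mult_left_le_one_le)
        then have "x * z - L \<le> (x - L) * z"
          by (simp add: algebra_simps)
        also have "\<dots> \<le> \<phi> x * z"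
          using z by (intro mult_right_mono) (auto simp: \<phi>_def)
        finally show ?thesis
          using z by (simp add: \<phi>_def)
      qed
    qed
    also have "\<dots> = \<phi> x"
      using mean by simp
    finally show ?thesis
      unfolding frag_op_def using \<open>0 \<le> \<alpha>\<close> rpow_nonneg[of x \<gamma>]
      by (intro mult_nonneg_nonpos) auto
  qed
  have "(LINT x|\<mu>0. \<phi> x) = 0"
  proof (rule integral_eq_zero_AE)
    show "AE x in \<mu>0. \<phi> x = 0"
      using AE_le_of_msupp[OF \<mu>0] by eventually_elim (simp add: \<phi>_def)
  qed
  moreover have "(LINT s:{0..t}|lborel. LINT x|\<mu> s. frag_op \<alpha> \<gamma> \<kappa> \<phi> x) \<le> 0"
  proof -
    have "0 \<le> - (LINT x|\<mu> s. frag_op \<alpha> \<gamma> \<kappa> \<phi> x)" if "s \<ge> 0" for s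
      using op_nonpos space_nonneg_measures[OF nonneg_solutionD(1)[OF sol that]]
      by (subst integral_minus[symmetric]) (intro Bochner_Integration.integral_nonneg, auto)
    then have "0 \<le> (LINT s|lborel. - (indicator {0..t} s *\<^sub>R (LINT x|\<mu> s. frag_op \<alpha> \<gamma> \<kappa> \<phi> x)))"
      by (intro Bochner_Integration.integral_nonneg) (auto split: split_indicator)
    then show ?thesis
      unfolding set_lebesgue_integral_def by simp
  qed
  ultimately have "(LINT x|\<mu> t. \<phi> x) \<le> 0"
    using nonneg_solutionD(3)[OF sol \<open>t \<ge> 0\<close> test] by simp
  moreover have "0 \<le> (LINT x|\<mu> t. \<phi> x)"
    by (intro Bochner_Integration.integral_nonneg) (simp add: \<phi>_def)
  ultimately have "(LINT x|\<mu> t. \<phi> x) = 0"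
    by simp
  then have "AE x in \<mu> t. \<phi> x = 0"
    using nonneg_solutionD(2)[OF sol \<open>t \<ge> 0\<close> test]
    by (subst (asm) integral_nonneg_eq_0_iff_AE) (auto simp: \<phi>_def)
  then show ?thesis
    by eventually_elim (simp add: \<phi>_def max_def split: if_splits)
qed

text \<open>
  The order of the quantifiers matters for uniqueness: \<open>\<psi>\<close> depends on \<open>\<phi>\<close> only, so the identities
  for two solutions can be subtracted.
\<close>

lemma solution_duhamel:
  assumes "0 \<le> \<alpha>" "0 \<le> \<gamma>" "0 \<le> L" and kernel: "fragmentation_kernel \<kappa> N"
    and datum: "admissible_datum L \<mu>0"
    and C: "\<alpha> * rpow L \<gamma> * (1 + N) \<le> C" and \<phi>: "\<phi> \<in> test_ball"
  obtains \<psi> where "\<psi> \<in> test_ball"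
    and "\<And>\<mu> t. nonneg_solution \<alpha> \<gamma> \<kappa> \<mu>0 \<mu> \<Longrightarrow> t \<ge> 0 \<Longrightarrow>
           (LINT x|\<mu> t. \<phi> x) = (LINT x|\<mu>0. \<phi> x) + C * (LINT s:{0..t}|lborel. LINT x|\<mu> s. \<psi> x)"
proof -
  have \<kappa>: "\<kappa> \<in> nonneg_measures" and mass: "(LINT z:{0..1}|\<kappa>. 1) = N"
    using kernel by (auto simp: fragmentation_kernel_def)
  obtain \<psi> where \<psi>: "\<psi> \<in> test_ball"
    "\<And>\<rho>. \<rho> \<in> nonneg_measures \<Longrightarrow> (AE x in \<rho>. x \<le> L) \<Longrightarrow>
       (LINT x|\<rho>. frag_op \<alpha> \<gamma> \<kappa> \<phi> x) = C * (LINT x|\<rho>. \<psi> x)"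
    using frag_op_rescaled[OF assms(1-3) \<kappa> \<phi>] C unfolding mass by metis
  show ?thesis
  proof
    fix \<mu> t assume sol: "nonneg_solution \<alpha> \<gamma> \<kappa> \<mu>0 \<mu>" and "t \<ge> (0::real)"
    have "(LINT s:{0..t}|lborel. LINT x|\<mu> s. frag_op \<alpha> \<gamma> \<kappa> \<phi> x)
          = (LINT s:{0..t}|lborel. C * (LINT x|\<mu> s. \<psi> x))"
      using \<psi>(2) nonneg_solutionD(1)[OF sol] solution_concentrated[OF assms(1,3) kernel datum sol]
      by (intro set_lebesgue_integral_cong) auto
    then show "(LINT x|\<mu> t. \<phi> x) = (LINT x|\<mu>0. \<phi> x) + C * (LINT s:{0..t}|lborel. LINT x|\<mu> s. \<psi> x)"
      using nonneg_solutionD(3)[OF sol \<open>t \<ge> 0\<close> test_function_test_ball[OF \<phi>]] by simp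
  qed (rule \<psi>(1))
qed

text \<open>This supplies the a priori bound that starts the iteration in the Gronwall inequality.\<close>

lemma total_mass_bounded:
  assumes "nonneg_solution \<alpha> \<gamma> \<kappa> \<mu>0 \<mu>"
  obtains M :: real where "\<And>t. t \<in> {0..T} \<Longrightarrow> (LINT x|\<mu> t. 1) \<le> M"
proof -
  have "compact ((\<lambda>t. LINT x|\<mu> t. 1 :: real) ` {0..T})"
    by (intro compact_continuous_image continuous_on_subset[OF
          continuous_on_integral_test_ball[OF assms one_in_test_ball]]) auto
  then have "bdd_above ((\<lambda>t. LINT x|\<mu> t. 1 :: real) ` {0..T})"
    by (intro bounded_imp_bdd_above compact_imp_bounded)
  then show ?thesis
    using that by (meson bdd_above.E image_eqI)
qed

lemma set_integrable_integral_test_ball: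
  assumes "nonneg_solution \<alpha> \<gamma> \<kappa> \<mu>0 \<mu>" "\<phi> \<in> test_ball"
  shows "set_integrable lborel {0..t} (\<lambda>s. LINT x|\<mu> s. \<phi> x)"
  by (intro borel_integrable_atLeastAtMost'
        continuous_on_subset[OF continuous_on_integral_test_ball[OF assms]]) auto

lemma total_mass_growth:
  assumes "0 \<le> \<alpha>" "0 \<le> \<gamma>" "0 \<le> L" "fragmentation_kernel \<kappa> N"
    and datum: "admissible_datum L \<mu>0"
    and "\<alpha> * rpow L \<gamma> * (1 + N) \<le> C" "0 \<le> C"
    and sol: "nonneg_solution \<alpha> \<gamma> \<kappa> \<mu>0 \<mu>" and "0 \<le> t"
  shows "(LINT x|\<mu> t. 1) \<le> (LINT x|\<mu>0. 1) * exp (C * t)"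
proof -
  have \<mu>0: "\<mu>0 \<in> nonneg_measures"
    using datum by (simp add: admissible_datum_def)
  obtain M :: real where M: "\<And>s. s \<in> {0..t} \<Longrightarrow> (LINT x|\<mu> s. 1) \<le> M"
    using total_mass_bounded[OF sol] by blast
  show ?thesis
  proof (rule gronwall_family[where I = test_ball and T = t and f = "\<lambda>\<phi> s. LINT x|\<mu> s. \<phi> x"])
    show "(LINT x|\<mu> s. \<phi> x) \<le> M" if "\<phi> \<in> test_ball" "s \<in> {0..t}" for \<phi> s
      using abs_integral_test_ball_le[OF nonneg_solutionD(1)[OF sol] that(1), of s] M[OF that(2)] that(2)
      by simp
    show "set_integrable lborel {0..s} (\<lambda>s. LINT x|\<mu> s. \<phi> x)" if "\<phi> \<in> test_ball" for \<phi> s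
      by (rule set_integrable_integral_test_ball[OF sol that])
    show "\<exists>\<psi>\<in>test_ball. (LINT x|\<mu> s. \<phi> x)
            \<le> (LINT x|\<mu>0. 1) + C * (LINT s:{0..s}|lborel. LINT x|\<mu> s. \<psi> x)"
      if \<phi>: "\<phi> \<in> test_ball" and s: "s \<in> {0..t}" for \<phi> s
    proof -
      obtain \<psi> where \<psi>: "\<psi> \<in> test_ball"
        "(LINT x|\<mu> s. \<phi> x) = (LINT x|\<mu>0. \<phi> x) + C * (LINT s:{0..s}|lborel. LINT x|\<mu> s. \<psi> x)"
        using solution_duhamel[OF assms(1-6) \<phi>] sol s by (metis atLeastAtMost_iff)
      with abs_integral_test_ball_le[OF \<mu>0 \<phi>] show ?thesis
        by (intro bexI[of _ \<psi>]) auto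
    qed
  qed (use assms one_in_test_ball in auto)
qed

text \<open>
  The Gronwall inequality with \<open>a = 0\<close>; the one-sided bound it gives is made two-sided by exchanging
  the two solutions.
\<close>

lemma solution_unique:
  assumes "0 \<le> \<alpha>" "0 \<le> \<gamma>" "0 \<le> L" and kernel: "fragmentation_kernel \<kappa> N"
    and datum: "admissible_datum L \<mu>0"
    and sol_\<mu>: "nonneg_solution \<alpha> \<gamma> \<kappa> \<mu>0 \<mu>" and sol_\<nu>: "nonneg_solution \<alpha> \<gamma> \<kappa> \<mu>0 \<nu>"
    and "0 \<le> t"
  shows "\<nu> t = \<mu> t"
proof -
  define C where "C = max 0 (\<alpha> * rpow L \<gamma> * (1 + N))"
  have C: "\<alpha> * rpow L \<gamma> * (1 + N) \<le> C" "0 \<le> C"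
    by (auto simp: C_def)
  have le: "(LINT x|\<mu> t. \<phi> x) - (LINT x|\<nu> t. \<phi> x) \<le> 0"
    if \<phi>: "\<phi> \<in> test_ball"
      and sol_\<mu>: "nonneg_solution \<alpha> \<gamma> \<kappa> \<mu>0 \<mu>" and sol_\<nu>: "nonneg_solution \<alpha> \<gamma> \<kappa> \<mu>0 \<nu>"
    for \<phi> \<mu> \<nu>
  proof -
    obtain M :: real where M: "\<And>s. s \<in> {0..t} \<Longrightarrow> (LINT x|\<mu> s. 1) \<le> M"
      using total_mass_bounded[OF sol_\<mu>] by blast
    obtain K :: real where K: "\<And>s. s \<in> {0..t} \<Longrightarrow> (LINT x|\<nu> s. 1) \<le> K"
      using total_mass_bounded[OF sol_\<nu>] by blast
    have "(LINT x|\<mu> t. \<phi> x) - (LINT x|\<nu> t. \<phi> x) \<le> 0 * exp (C * t)"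
    proof (rule gronwall_family[where I = test_ball and T = t
          and f = "\<lambda>\<phi> s. (LINT x|\<mu> s. \<phi> x) - (LINT x|\<nu> s. \<phi> x)"])
      show "(LINT x|\<mu> s. \<phi> x) - (LINT x|\<nu> s. \<phi> x) \<le> M + K"
        if "\<phi> \<in> test_ball" "s \<in> {0..t}" for \<phi> s
        using abs_integral_test_ball_le[OF nonneg_solutionD(1)[OF sol_\<mu>] that(1), of s]
          abs_integral_test_ball_le[OF nonneg_solutionD(1)[OF sol_\<nu>] that(1), of s]
          M[OF that(2)] K[OF that(2)] that(2)
        by simp
      show "set_integrable lborel {0..s} (\<lambda>s. (LINT x|\<mu> s. \<phi> x) - (LINT x|\<nu> s. \<phi> x))"
        if "\<phi> \<in> test_ball" for \<phi> s
        by (intro set_integral_diff set_integrable_integral_test_ball[OF sol_\<mu> that]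
              set_integrable_integral_test_ball[OF sol_\<nu> that])
      show "\<exists>\<psi>\<in>test_ball. (LINT x|\<mu> s. \<phi> x) - (LINT x|\<nu> s. \<phi> x)
              \<le> 0 + C * (LINT s:{0..s}|lborel. (LINT x|\<mu> s. \<psi> x) - (LINT x|\<nu> s. \<psi> x))"
        if \<phi>: "\<phi> \<in> test_ball" and s: "s \<in> {0..t}" for \<phi> s
      proof -
        obtain \<psi> where \<psi>: "\<psi> \<in> test_ball"
          "\<And>\<rho>. nonneg_solution \<alpha> \<gamma> \<kappa> \<mu>0 \<rho> \<Longrightarrow> (LINT x|\<rho> s. \<phi> x) =
             (LINT x|\<mu>0. \<phi> x) + C * (LINT s:{0..s}|lborel. LINT x|\<rho> s. \<psi> x)"
          using solution_duhamel[OF assms(1-5) C(1) \<phi>] s by (metis atLeastAtMost_iff)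
        have "(LINT s:{0..s}|lborel. (LINT x|\<mu> s. \<psi> x) - (LINT x|\<nu> s. \<psi> x))
            = (LINT s:{0..s}|lborel. LINT x|\<mu> s. \<psi> x) - (LINT s:{0..s}|lborel. LINT x|\<nu> s. \<psi> x)"
          by (intro set_integral_diff set_integrable_integral_test_ball[OF sol_\<mu> \<psi>(1)]
                set_integrable_integral_test_ball[OF sol_\<nu> \<psi>(1)])
        then show ?thesis
          using \<psi>(1) \<psi>(2)[OF sol_\<mu>] \<psi>(2)[OF sol_\<nu>]
          by (intro bexI[of _ \<psi>]) (simp_all add: right_diff_distrib)
      qed
    qed (use C \<phi> \<open>0 \<le> t\<close> in auto)
    then show ?thesis
      by simp
  qed
  show ?thesis
  proof (rule nonneg_measures_eqI)
    show "(LINT x|\<nu> t. \<phi> x) = (LINT x|\<mu> t. \<phi> x)" if "\<phi> \<in> test_ball" for \<phi>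
      using le[OF that sol_\<mu> sol_\<nu>] le[OF that sol_\<nu> sol_\<mu>] by simp
  qed (use nonneg_solutionD(1) sol_\<mu> sol_\<nu> \<open>0 \<le> t\<close> in blast)+
qed

theorem theorem1:
  fixes \<alpha> \<gamma> N L :: real
    and \<kappa> \<mu>0 :: "real measure"
    and \<mu> :: "real \<Rightarrow> real measure"
  assumes "\<alpha> > 0" and "\<gamma> \<ge> 0" and "L \<ge> 0"
    and "fragmentation_kernel \<kappa> N"
    and "admissible_datum L \<mu>0"
    and "tv_continuous \<mu>"
    and "nonneg_solution \<alpha> \<gamma> \<kappa> \<mu>0 \<mu>"
  shows "(\<forall>t>0. msupp (\<mu> t) \<subseteq> {0..L} \<and>
            tv_norm (\<mu> t) \<le> tv_norm \<mu>0 * exp (\<alpha> * rpow (2 * L) \<gamma> * (1 + N) * t) \<and>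
            (LINT x|\<mu> t. x) = (LINT x|\<mu>0. x)) \<and>
         (\<forall>\<nu>. tv_continuous \<nu> \<longrightarrow> nonneg_solution \<alpha> \<gamma> \<kappa> \<mu>0 \<nu> \<longrightarrow>
            (\<forall>t\<ge>0. \<nu> t = \<mu> t))"
proof (intro conjI allI impI)
  have \<mu>0: "\<mu>0 \<in> nonneg_measures"
    using assms(5) by (simp add: admissible_datum_def)
  have "N = (LINT z:{0..1}|\<kappa>. 1)"
    using assms(4) by (simp add: fragmentation_kernel_def)
  then have "N \<ge> 0"
    by (auto simp: set_lebesgue_integral_def intro!: Bochner_Integration.integral_nonneg)
  define C where "C = \<alpha> * rpow (2 * L) \<gamma> * (1 + N)"
  have C: "\<alpha> * rpow L \<gamma> * (1 + N) \<le> C" "0 \<le> C"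
    unfolding C_def using assms(1-3) \<open>N \<ge> 0\<close> rpow_nonneg[of "2 * L" \<gamma>]
    by (auto intro!: mult_right_mono mult_left_mono rpow_mono)
  fix t :: real assume t: "t > 0"
  have \<mu>t: "\<mu> t \<in> nonneg_measures"
    using nonneg_solutionD(1)[OF assms(7)] t by simp
  show "msupp (\<mu> t) \<subseteq> {0..L}"
    using solution_concentrated[OF _ assms(3-5,7)] assms(1) t by (intro msupp_of_AE_le[OF \<mu>t]) simp
  show "tv_norm (\<mu> t) \<le> tv_norm \<mu>0 * exp (\<alpha> * rpow (2 * L) \<gamma> * (1 + N) * t)"
    using total_mass_growth[OF _ assms(2-5) C assms(7)] assms(1) t
    by (simp add: tv_norm_nonneg_measure \<mu>0 \<mu>t C_def)
  show "(LINT x|\<mu> t. x) = (LINT x|\<mu>0. x)"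
    using first_moment_conserved[OF assms(4,7)] t by simp
next
  fix \<nu> and t :: real
  assume "nonneg_solution \<alpha> \<gamma> \<kappa> \<mu>0 \<nu>" "t \<ge> 0"
  then show "\<nu> t = \<mu> t"
    using solution_unique[OF _ assms(2-5,7)] assms(1) by simp
qed

end
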